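(* Let $N\ge2$ be even and $\rho\in(0,1)$. Let $\omega_1<\dots<\omega_N$ in $(0,\pi)$ be the eigenfrequencies of the AR(1) covariance matrix $\mathbf{R}_N(\rho)=[\rho^{|i-j|}]_{i,j=0}^{N-1}$. Then no eigenfrequency $\omega_m$ lies on the DST-I grid $\{k\pi/(N+1): k\in\mathbb{Z}\}$, and no eigenfrequency $\omega_m$ lies on the DCT-II grid $\{n\pi/N: n\in\mathbb{Z}\}$.
   Context: The eigenfrequencies of $\mathbf{R}_N(\rho)$ are defined as follows. Let $\theta(\omega)=\arctan\frac{\rho\sin\omega}{1-\rho\cos\omega}$ for $\omega\in(0,\pi)$. For each $m=1,\dots,N$ the equation $(N+1)\omega+2\theta(\omega)=m\pi$ has a unique root $\omega_m\in(0,\pi)$; these roots are the eigenfrequencies, and they satisfy $\omega_1<\dots<\omega_N$. Equivalently, the eigenvalues of $\mathbf{R}_N(\rho)$ are $\lambda_m=\frac{1-\rho^2}{1-2\rho\cos\omega_m+\rho^2}$, $m=1,\dots,N$, with $\omega_m\in(0,\pi)$, and the corresponding eigenvectors are proportional to $\big(\sin(\omega_m(k+1)+\theta(\omega_m))\big)_{k=0}^{N-1}$. *)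

theory Defs
  imports "Complex_Main" "Jordan_Normal_Form.Char_Poly"
begin

definition ar1_cov :: "nat \<Rightarrow> real \<Rightarrow> real mat" where
  "ar1_cov N \<rho> = mat N N (\<lambda>(i, j). \<rho> ^ nat \<bar>int i - int j\<bar>)"

definition ar1_phase :: "real \<Rightarrow> real \<Rightarrow> real" where
  "ar1_phase \<rho> \<omega> = arctan (\<rho> * sin \<omega> / (1 - \<rho> * cos \<omega>))"

definition is_eigenfreq :: "nat \<Rightarrow> real \<Rightarrow> nat \<Rightarrow> real \<Rightarrow> bool" where
  "is_eigenfreq N \<rho> m \<omega> \<longleftrightarrow>
     0 < \<omega> \<and> \<omega> < pi \<and> (real N + 1) * \<omega> + 2 * ar1_phase \<rho> \<omega> = real m * pi"

text \<open>
  The unique root of the phase equation; see \<open>ex1_eigenfreq\<close> below for \<open>1 \<le> m \<le> N\<close>.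
  Outside that range of \<open>m\<close> the value is unspecified.
\<close>
definition eigenfreq :: "nat \<Rightarrow> real \<Rightarrow> nat \<Rightarrow> real" where
  "eigenfreq N \<rho> m = (THE \<omega>. is_eigenfreq N \<rho> m \<omega>)"

definition ar1_eigval :: "real \<Rightarrow> real \<Rightarrow> real" where
  "ar1_eigval \<rho> \<omega> = (1 - \<rho>\<^sup>2) / (1 - 2 * \<rho> * cos \<omega> + \<rho>\<^sup>2)"

definition dst1_grid :: "nat \<Rightarrow> real set" where
  "dst1_grid N = {real_of_int k * pi / (real N + 1) |k. k \<in> (UNIV :: int set)}"

definition dct2_grid :: "nat \<Rightarrow> real set" where
  "dct2_grid N = {real_of_int n * pi / real N |n. n \<in> (UNIV :: int set)}"


subsection \<open>The eigenfrequencies are well defined and strictly increasing\<close>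

lemma ar1_den_pos:
  fixes \<rho> :: real assumes "0 < \<rho>" "\<rho> < 1"
  shows "0 < 1 - \<rho> * cos \<omega>" and "0 < 1 - 2 * \<rho> * cos \<omega> + \<rho>\<^sup>2"
proof -
  have c: "\<rho> * cos \<omega> \<le> \<rho> * 1" using assms by (intro mult_left_mono) auto
  then show "0 < 1 - \<rho> * cos \<omega>" using assms by linarith
  have "0 < (1 - \<rho>)\<^sup>2" using assms by simp
  also have "\<dots> \<le> 1 - 2 * \<rho> * cos \<omega> + \<rho>\<^sup>2" using c by (simp add: power2_eq_square algebra_simps)
  finally show "0 < 1 - 2 * \<rho> * cos \<omega> + \<rho>\<^sup>2" .
qed

lemma ar1_phase_deriv:
  fixes \<rho> :: real assumes "0 < \<rho>" "\<rho> < 1"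
  shows "(ar1_phase \<rho> has_real_derivative
           (\<rho> * cos \<omega> - \<rho>\<^sup>2) / (1 - 2 * \<rho> * cos \<omega> + \<rho>\<^sup>2)) (at \<omega>)"
proof -
  define c s where "c = cos \<omega>" and "s = sin \<omega>"
  have cs: "s\<^sup>2 = 1 - c\<^sup>2" by (simp add: c_def s_def sin_squared_eq)
  have d: "0 < 1 - \<rho> * c" "0 < 1 - 2 * \<rho> * c + \<rho>\<^sup>2"
    using ar1_den_pos[OF assms] by (auto simp: c_def)
  have sq: "(1 - \<rho> * c)\<^sup>2 + (\<rho> * s)\<^sup>2 = 1 - 2 * \<rho> * c + \<rho>\<^sup>2"
    unfolding power_mult_distrib cs by (simp add: power2_eq_square algebra_simps)
  have "(ar1_phase \<rho> has_real_derivative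
      ((\<rho> * c) * (1 - \<rho> * c) - (\<rho> * s) * (\<rho> * s)) / ((1 - \<rho> * c) * (1 - \<rho> * c))
        / (1 + (\<rho> * s / (1 - \<rho> * c))\<^sup>2)) (at \<omega>)"
  proof -
    have "((\<lambda>x. \<rho> * sin x / (1 - \<rho> * cos x)) has_real_derivative
        ((\<rho> * c) * (1 - \<rho> * c) - (\<rho> * s) * (\<rho> * s)) / ((1 - \<rho> * c) * (1 - \<rho> * c))) (at \<omega>)"
      using d(1) unfolding c_def s_def by (auto intro!: derivative_eq_intros)
    from DERIV_chain2[OF DERIV_arctan this] show ?thesis
      unfolding ar1_phase_def[abs_def] c_def s_def by (simp add: divide_inverse mult.commute)
  qed
  also have "1 + (\<rho> * s / (1 - \<rho> * c))\<^sup>2 = (1 - 2 * \<rho> * c + \<rho>\<^sup>2) / (1 - \<rho> * c)\<^sup>2"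
    unfolding sq[symmetric] using d(1) by (simp add: power_divide field_simps)
  also have "(\<rho> * c) * (1 - \<rho> * c) - (\<rho> * s) * (\<rho> * s) = \<rho> * c - \<rho>\<^sup>2 * (c\<^sup>2 + s\<^sup>2)"
    by (simp add: power2_eq_square algebra_simps)
  also have "c\<^sup>2 + s\<^sup>2 = 1" using cs by simp
  finally show ?thesis using d by (simp add: c_def power2_eq_square)
qed

lemma phase_eq_strict_mono:
  fixes \<rho> a b :: real assumes \<rho>: "0 < \<rho>" "\<rho> < 1" and "a < b"
  shows "(real N + 1) * a + 2 * ar1_phase \<rho> a < (real N + 1) * b + 2 * ar1_phase \<rho> b"
proof (rule DERIV_pos_imp_increasing[OF \<open>a < b\<close>])
  fix x :: real
  let ?D = "(\<rho> * cos x - \<rho>\<^sup>2) / (1 - 2 * \<rho> * cos x + \<rho>\<^sup>2)"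
  have "((\<lambda>x. (real N + 1) * x + 2 * ar1_phase \<rho> x) has_real_derivative
      (real N + 1) + 2 * ?D) (at x)"
    using ar1_phase_deriv[OF \<rho>, of x] by (auto intro!: derivative_eq_intros)
  moreover have "1 + 2 * ?D = (1 - \<rho>\<^sup>2) / (1 - 2 * \<rho> * cos x + \<rho>\<^sup>2)"
    using ar1_den_pos(2)[OF \<rho>, of x] by (simp add: field_simps)
  moreover have "0 < (1 - \<rho>\<^sup>2) / (1 - 2 * \<rho> * cos x + \<rho>\<^sup>2)"
    using ar1_den_pos(2)[OF \<rho>, of x] \<rho> by (intro divide_pos_pos) (auto simp: power_less_one_iff)
  ultimately show "\<exists>y. ((\<lambda>x. (real N + 1) * x + 2 * ar1_phase \<rho> x) has_real_derivative y) (at x) \<and> 0 < y"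
    by (intro exI[of _ "(real N + 1) + 2 * ?D"]) auto
qed

lemma is_eigenfreq_less:
  fixes \<rho> :: real assumes \<rho>: "0 < \<rho>" "\<rho> < 1"
    and "is_eigenfreq N \<rho> m a" "is_eigenfreq N \<rho> n b" "m < n"
  shows "a < b"
proof (rule ccontr)
  assume "\<not> a < b"
  then have "(real N + 1) * b + 2 * ar1_phase \<rho> b \<le> (real N + 1) * a + 2 * ar1_phase \<rho> a"
    using phase_eq_strict_mono[OF \<rho>, of b a N] by (cases "a = b") auto
  then have "real n * pi \<le> real m * pi" using assms by (simp add: is_eigenfreq_def)
  then show False using \<open>m < n\<close> by simp
qed

lemma ex1_eigenfreq:
  fixes \<rho> :: real assumes \<rho>: "0 < \<rho>" "\<rho> < 1" and m: "1 \<le> m" "m \<le> N"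
  shows "\<exists>!\<omega>. is_eigenfreq N \<rho> m \<omega>"
proof -
  let ?g = "\<lambda>x. (real N + 1) * x + 2 * ar1_phase \<rho> x"
  have g0: "?g 0 = 0" and gpi: "?g pi = (real N + 1) * pi" by (auto simp: ar1_phase_def)
  have m0: "0 < real m * pi" using m by simp
  have mN: "real m * pi < (real N + 1) * pi" using m by simp
  have "\<exists>x. 0 \<le> x \<and> x \<le> pi \<and> ?g x = real m * pi"
  proof (rule IVT)
    show "?g 0 \<le> real m * pi" using g0 m0 by linarith
    show "real m * pi \<le> ?g pi" using gpi mN by linarith
    show "\<forall>x. 0 \<le> x \<and> x \<le> pi \<longrightarrow> isCont ?g x"
      using DERIV_isCont[OF ar1_phase_deriv[OF \<rho>]] by (auto intro!: continuous_intros)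
  qed simp
  then obtain x where x: "0 \<le> x" "x \<le> pi" "?g x = real m * pi" by blast
  have "x \<noteq> 0" using x(3) g0 m0 by auto
  moreover have "x \<noteq> pi" using x(3) gpi mN by auto
  ultimately have "is_eigenfreq N \<rho> m x" using x unfolding is_eigenfreq_def by auto
  moreover have "y = x" if "is_eigenfreq N \<rho> m y" for y
    using that x(3) phase_eq_strict_mono[OF \<rho>, of x y N] phase_eq_strict_mono[OF \<rho>, of y x N]
    by (cases x y rule: linorder_cases) (auto simp: is_eigenfreq_def)
  ultimately show ?thesis by blast
qed

lemma eigenfreq:
  fixes \<rho> :: real assumes "0 < \<rho>" "\<rho> < 1" "1 \<le> m" "m \<le> N"
  shows "is_eigenfreq N \<rho> m (eigenfreq N \<rho> m)"
  unfolding eigenfreq_def by (rule theI') (rule ex1_eigenfreq[OF assms])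

lemma eigenfreq_strict_mono_on:
  fixes \<rho> :: real assumes "0 < \<rho>" "\<rho> < 1"
  shows "strict_mono_on {1..N} (eigenfreq N \<rho>)"
proof (rule strict_mono_onI)
  fix m n assume "m \<in> {1..N}" "n \<in> {1..N}" "m < n"
  then show "eigenfreq N \<rho> m < eigenfreq N \<rho> n"
    by (intro is_eigenfreq_less[OF assms eigenfreq[OF assms] eigenfreq[OF assms]]) auto
qed


subsection \<open>The eigenfrequencies parametrise the spectrum of the AR(1) covariance matrix\<close>

text \<open>
  If \<open>v (k - 1) + v (k + 1) = 2 cos \<omega> v k\<close> and \<open>v\<close> satisfies the two boundary conditions,
  the convolution of \<open>v\<close> with \<open>\<rho> ^ \<bar>k\<bar>\<close> splits into two telescoping one-sided sums.
\<close>
lemma ar1_convolution: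
  fixes \<rho> c :: real and v :: "nat \<Rightarrow> real"
  defines "D \<equiv> 1 - 2 * \<rho> * c + \<rho>\<^sup>2"
  assumes D: "D \<noteq> 0"
    and rec: "\<And>k. v k + v (Suc (Suc k)) = 2 * c * v (Suc k)"
    and left: "v 0 = \<rho> * v 1" and right: "v (Suc N) = \<rho> * v N" and k: "k < N"
  shows "(\<Sum>j<N. \<rho> ^ nat \<bar>int k - int j\<bar> * v (Suc j)) = (1 - \<rho>\<^sup>2) / D * v (Suc k)"
proof -
  have F: "D * (\<Sum>j<n. \<rho> ^ (n - 1 - j) * v (Suc j)) = v n - \<rho> * v (Suc n)" for n
  proof (induction n)
    case 0 then show ?case using left by simp
  next
    case (Suc n)
    have "(\<Sum>j<n. \<rho> ^ (n - j) * v (Suc j)) = \<rho> * (\<Sum>j<n. \<rho> ^ (n - 1 - j) * v (Suc j))"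
      unfolding sum_distrib_left
    proof (rule sum.cong[OF refl])
      fix j assume "j \<in> {..<n}"
      then have "n - j = Suc (n - 1 - j)" by auto
      then show "\<rho> ^ (n - j) * v (Suc j) = \<rho> * (\<rho> ^ (n - 1 - j) * v (Suc j))" by simp
    qed
    then have "D * (\<Sum>j<Suc n. \<rho> ^ (Suc n - 1 - j) * v (Suc j))
        = \<rho> * (D * (\<Sum>j<n. \<rho> ^ (n - 1 - j) * v (Suc j))) + D * v (Suc n)"
      by (simp add: algebra_simps)
    also note Suc.IH
    finally have "D * (\<Sum>j<Suc n. \<rho> ^ (Suc n - 1 - j) * v (Suc j))
        = \<rho> * (v n - \<rho> * v (Suc n)) + D * v (Suc n)" .
    moreover have "v n = 2 * c * v (Suc n) - v (Suc (Suc n))" using rec[of n] by simp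
    ultimately show ?case unfolding D_def by (simp add: power2_eq_square algebra_simps)
  qed
  have B: "D * (\<Sum>j=k..<N. \<rho> ^ (j - k) * v (Suc j)) = v (Suc k) - \<rho> * v k" if "k \<le> N" for k
    using that
  proof (induction k rule: inc_induct)
    case base then show ?case using right by simp
  next
    case (step k)
    have "(\<Sum>j=Suc k..<N. \<rho> ^ (j - k) * v (Suc j))
        = \<rho> * (\<Sum>j=Suc k..<N. \<rho> ^ (j - Suc k) * v (Suc j))"
      unfolding sum_distrib_left
    proof (rule sum.cong[OF refl])
      fix j assume "j \<in> {Suc k..<N}"
      then have "j - k = Suc (j - Suc k)" by auto
      then show "\<rho> ^ (j - k) * v (Suc j) = \<rho> * (\<rho> ^ (j - Suc k) * v (Suc j))" by simp
    qed
    then have "D * (\<Sum>j=k..<N. \<rho> ^ (j - k) * v (Suc j))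
        = D * v (Suc k) + \<rho> * (D * (\<Sum>j=Suc k..<N. \<rho> ^ (j - Suc k) * v (Suc j)))"
      using step.hyps by (simp add: sum.atLeast_Suc_lessThan distrib_left mult.left_commute)
    also note step.IH
    finally have "D * (\<Sum>j=k..<N. \<rho> ^ (j - k) * v (Suc j))
        = D * v (Suc k) + \<rho> * (v (Suc (Suc k)) - \<rho> * v (Suc k))" .
    moreover have "v (Suc (Suc k)) = 2 * c * v (Suc k) - v k" using rec[of k] by simp
    ultimately show ?case unfolding D_def by (simp add: power2_eq_square algebra_simps)
  qed
  let ?f = "\<lambda>j. \<rho> ^ nat \<bar>int k - int j\<bar> * v (Suc j)"
  have "{..<N} = {..<k} \<union> {k..<N}" using k by auto
  then have split: "sum ?f {..<N} = sum ?f {..<k} + sum ?f {k..<N}"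
    by (simp add: sum.union_disjoint ivl_disj_int)
  have "sum ?f {..<k} = (\<Sum>j<k. \<rho> * (\<rho> ^ (k - 1 - j) * v (Suc j)))"
  proof (rule sum.cong[OF refl])
    fix j assume "j \<in> {..<k}"
    then have "nat \<bar>int k - int j\<bar> = Suc (k - 1 - j)" by auto
    then show "?f j = \<rho> * (\<rho> ^ (k - 1 - j) * v (Suc j))" by simp
  qed
  then have L: "D * sum ?f {..<k} = \<rho> * (v k - \<rho> * v (Suc k))"
    using F[of k] by (simp add: sum_distrib_left[symmetric])
  have "sum ?f {k..<N} = (\<Sum>j=k..<N. \<rho> ^ (j - k) * v (Suc j))"
  proof (rule sum.cong[OF refl])
    fix j assume "j \<in> {k..<N}"
    then have "nat \<bar>int k - int j\<bar> = j - k" by auto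
    then show "?f j = \<rho> ^ (j - k) * v (Suc j)" by (simp only:)
  qed
  then have R: "D * sum ?f {k..<N} = v (Suc k) - \<rho> * v k" using B[of k] k by simp
  have "D * sum ?f {..<N} = (1 - \<rho>\<^sup>2) * v (Suc k)"
    unfolding split distrib_left L R by (simp add: power2_eq_square algebra_simps)
  then show ?thesis using D by (simp add: field_simps)
qed

lemma eigenvector_ar1_cov:
  fixes \<rho> :: real assumes \<rho>: "0 < \<rho>" "\<rho> < 1" and N: "1 \<le> N" and ev: "is_eigenfreq N \<rho> m \<omega>"
  shows "eigenvector (ar1_cov N \<rho>)
           (vec N (\<lambda>k. sin (\<omega> * (real k + 1) + ar1_phase \<rho> \<omega>))) (ar1_eigval \<rho> \<omega>)"
proof -
  define t where "t = ar1_phase \<rho> \<omega>"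
  define v where "v k = sin (\<omega> * real k + t)" for k
  have \<omega>: "0 < \<omega>" "\<omega> < pi" and eq: "(real N + 1) * \<omega> + 2 * t = real m * pi"
    using ev by (auto simp: is_eigenfreq_def t_def)
  have d: "0 < 1 - \<rho> * cos \<omega>" "0 < 1 - 2 * \<rho> * cos \<omega> + \<rho>\<^sup>2" by (rule ar1_den_pos[OF \<rho>])+
  have t: "0 < t" "t < pi / 2"
    using d(1) \<rho> \<omega> arctan_ubound[of "\<rho> * sin \<omega> / (1 - \<rho> * cos \<omega>)"]
    by (auto simp: t_def ar1_phase_def sin_gt_zero)
  have "tan t * (1 - \<rho> * cos \<omega>) = \<rho> * sin \<omega>"
    using d(1) by (simp add: t_def ar1_phase_def tan_arctan)
  moreover have "cos t \<noteq> 0" using t cos_gt_zero by force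
  ultimately have "sin t * (1 - \<rho> * cos \<omega>) = \<rho> * sin \<omega> * cos t"
    by (simp add: tan_def field_simps)
  then have st: "sin t = \<rho> * sin (\<omega> + t)" by (simp add: sin_add algebra_simps)
  have v0: "v 0 = \<rho> * v 1" using st by (simp add: v_def)
  have e: "\<omega> * real (Suc N) + t = real m * pi - t" "\<omega> * real N + t = real m * pi - (\<omega> + t)"
    using eq by (auto simp: algebra_simps)
  have vN: "v (Suc N) = \<rho> * v N" unfolding v_def e
    using st by (simp add: sin_diff[of "real m * pi"])
  have rec: "v k + v (Suc (Suc k)) = 2 * cos \<omega> * v (Suc k)" for k
  proof -
    define y where "y = \<omega> * real (Suc k) + t"
    have "\<omega> * real k + t = y - \<omega>" "\<omega> * real (Suc (Suc k)) + t = y + \<omega>"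
      by (auto simp: y_def algebra_simps)
    then show ?thesis unfolding v_def y_def[symmetric] by (simp add: sin_add sin_diff)
  qed
  let ?w = "vec N (\<lambda>k. v (Suc k))"
  have "ar1_cov N \<rho> *\<^sub>v ?w = ar1_eigval \<rho> \<omega> \<cdot>\<^sub>v ?w"
  proof (rule eq_vecI)
    fix k assume "k < dim_vec (ar1_eigval \<rho> \<omega> \<cdot>\<^sub>v ?w)"
    then have k: "k < N" by simp
    then have "(ar1_cov N \<rho> *\<^sub>v ?w) $ k = (\<Sum>j<N. \<rho> ^ nat \<bar>int k - int j\<bar> * v (Suc j))"
      by (simp add: ar1_cov_def scalar_prod_def lessThan_atLeast0)
    also have "\<dots> = ar1_eigval \<rho> \<omega> * v (Suc k)"
      unfolding ar1_eigval_def using d(2) rec v0 vN k by (intro ar1_convolution) auto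
    finally show "(ar1_cov N \<rho> *\<^sub>v ?w) $ k = (ar1_eigval \<rho> \<omega> \<cdot>\<^sub>v ?w) $ k" using k by simp
  qed (simp add: ar1_cov_def)
  moreover have "?w \<noteq> 0\<^sub>v N"
  proof
    assume "?w = 0\<^sub>v N"
    then have "?w $ 0 = 0\<^sub>v N $ 0" by simp
    then have "v (Suc 0) = 0" using N by simp
    then have "sin t = 0" using v0 by (simp add: v_def)
    then show False using t sin_gt_zero[of t] by simp
  qed
  moreover have "?w = vec N (\<lambda>k. sin (\<omega> * (real k + 1) + t))"
    by (rule eq_vecI) (auto simp: v_def add.commute)
  ultimately show ?thesis by (simp add: eigenvector_def ar1_cov_def t_def)
qed

lemma ar1_eigval_less:
  fixes \<rho> :: real assumes \<rho>: "0 < \<rho>" "\<rho> < 1" and "0 < a" "a < b" "b < pi"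
  shows "ar1_eigval \<rho> b < ar1_eigval \<rho> a"
proof -
  have "cos b < cos a" using assms by (intro cos_monotone_0_pi) auto
  then have "1 - 2 * \<rho> * cos a + \<rho>\<^sup>2 < 1 - 2 * \<rho> * cos b + \<rho>\<^sup>2" using \<rho> by simp
  moreover have "0 < 1 - \<rho>\<^sup>2" using \<rho> by (simp add: power_less_one_iff)
  ultimately show ?thesis unfolding ar1_eigval_def
    using ar1_den_pos(2)[OF \<rho>] by (intro divide_strict_left_mono) auto
qed

lemma spectrum_ar1_cov:
  fixes \<rho> :: real assumes \<rho>: "0 < \<rho>" "\<rho> < 1" and N: "1 \<le> N"
  shows "{l. eigenvalue (ar1_cov N \<rho>) l} = (\<lambda>m. ar1_eigval \<rho> (eigenfreq N \<rho> m)) ` {1..N}"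
    (is "?S = ?L ` _")
proof -
  have A: "ar1_cov N \<rho> \<in> carrier_mat N N" by (simp add: ar1_cov_def)
  let ?p = "char_poly (ar1_cov N \<rho>)"
  have p: "degree ?p = N" "?p \<noteq> 0" using degree_monic_char_poly[OF A] N by auto
  have S: "?S = {x. poly ?p x = 0}" using eigenvalue_root_char_poly[OF A] by auto
  have fin: "finite ?S" and card: "card ?S \<le> N"
    using poly_roots_finite[OF p(2)] card_poly_roots_bound[OF p(2)] p(1) by (auto simp: S)
  have sub: "?L ` {1..N} \<subseteq> ?S"
    using eigenvector_ar1_cov[OF \<rho> N eigenfreq[OF \<rho>]] by (fastforce simp: eigenvalue_def)
  have "?L n < ?L m" if "m \<in> {1..N}" "n \<in> {1..N}" "m < n" for m n
    using that eigenfreq[OF \<rho>, of m N] eigenfreq[OF \<rho>, of n N]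
      strict_mono_onD[OF eigenfreq_strict_mono_on[OF \<rho>] that]
    by (intro ar1_eigval_less[OF \<rho>]) (auto simp: is_eigenfreq_def)
  then have "inj_on ?L {1..N}" by (intro linorder_inj_onI) force+
  then have "card (?L ` {1..N}) = N" by (simp add: card_image)
  then show ?thesis using card_seteq[OF fin sub] card by simp
qed

end

(*
  With t = ar1_phase \<rho> \<omega> in (0, pi/2), a root of (N+1) \<omega> + 2 t = m pi on the DST-I grid
  would make 2 t a multiple of pi inside (0, pi).  On the DCT-II grid, \<omega> + 2 t would be a
  multiple of pi inside (0, 2 pi), hence pi; but the phase satisfies sin t = \<rho> sin (\<omega> + t), and
  \<omega> + t = pi - t turns this into sin t = \<rho> sin t, impossible since sin t > 0 and \<rho> < 1.
*)
theory Submission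
  imports Defs
begin

text \<open>Cancelling pi > 0 turns bounds between multiples of pi into integer bounds. This is used
  to see that (0, pi) contains no multiple of pi and (0, 2 pi) only pi itself.\<close>

lemma int_multiple_pi_between:
  fixes j k l :: int
  assumes "of_int j * pi < of_int k * pi" "of_int k * pi < of_int l * pi"
  shows "j < k" "k < l"
  using assms by simp_all

lemma ar1_phase_bounds:
  fixes \<rho> \<omega> :: real
  assumes \<rho>: "0 < \<rho>" "\<rho> < 1" and "0 < \<omega>" "\<omega> < pi"
  shows "0 < ar1_phase \<rho> \<omega>" "ar1_phase \<rho> \<omega> < pi / 2"
  using assms ar1_den_pos(1)[OF \<rho>, of \<omega>]
  unfolding ar1_phase_def by (simp add: sin_gt_zero, intro arctan_ubound)

text \<open>Clear the denominator in the formula for tan t, then apply the addition formula to sin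
  (\<omega> + t). This is the boundary relation v 0 = \<rho> v 1 of the eigenvector sequence v k =
  sin (\<omega> k + t).\<close>

lemma sin_ar1_phase:
  fixes \<rho> \<omega> :: real
  assumes \<rho>: "0 < \<rho>" "\<rho> < 1"
  shows "sin (ar1_phase \<rho> \<omega>) = \<rho> * sin (\<omega> + ar1_phase \<rho> \<omega>)"
proof -
  let ?t = "ar1_phase \<rho> \<omega>"
  have "tan ?t * (1 - \<rho> * cos \<omega>) = \<rho> * sin \<omega>"
    using ar1_den_pos(1)[OF \<rho>, of \<omega>] by (simp add: ar1_phase_def tan_arctan)
  moreover have "cos ?t \<noteq> 0"
    by (simp add: ar1_phase_def)
  ultimately have "sin ?t * (1 - \<rho> * cos \<omega>) = \<rho> * sin \<omega> * cos ?t"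
    by (simp add: tan_def field_simps)
  then show ?thesis by (simp add: sin_add algebra_simps)
qed

lemma eigenfreq_notin_dst1_grid:
  fixes \<rho> \<omega> :: real
  assumes \<rho>: "0 < \<rho>" "\<rho> < 1" and ev: "is_eigenfreq N \<rho> m \<omega>"
  shows "\<omega> \<notin> dst1_grid N"
proof
  assume "\<omega> \<in> dst1_grid N"
  then obtain k :: int where k: "(real N + 1) * \<omega> = of_int k * pi"
    by (auto simp: dst1_grid_def)
  have "0 < 2 * ar1_phase \<rho> \<omega>" "2 * ar1_phase \<rho> \<omega> < pi"
    using ar1_phase_bounds[OF \<rho>, of \<omega>] ev by (auto simp: is_eigenfreq_def)
  \<comment> \<open>Subtracting the grid relation from the phase equation removes all of (N + 1)
    \<omega>.\<close>
  moreover have "2 * ar1_phase \<rho> \<omega> = of_int (int m - k) * pi"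
    using ev k by (simp add: is_eigenfreq_def algebra_simps)
  ultimately show False
    using int_multiple_pi_between[of 0 "int m - k" 1] by simp
qed

lemma eigenfreq_notin_dct2_grid:
  fixes \<rho> \<omega> :: real
  assumes N: "0 < N" and \<rho>: "0 < \<rho>" "\<rho> < 1" and ev: "is_eigenfreq N \<rho> m \<omega>"
  shows "\<omega> \<notin> dct2_grid N"
proof
  let ?t = "ar1_phase \<rho> \<omega>"
  assume "\<omega> \<in> dct2_grid N"
  then obtain n :: int where n: "real N * \<omega> = of_int n * pi"
    using N by (auto simp: dct2_grid_def)
  have \<omega>: "0 < \<omega>" "\<omega> < pi" using ev by (auto simp: is_eigenfreq_def)
  have t: "0 < ?t" "?t < pi / 2" using ar1_phase_bounds[OF \<rho> \<omega>] .
  \<comment> \<open>Here the grid relation cancels only N \<omega>, so one \<omega> survives beside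
    the phase.\<close>
  have eq: "\<omega> + 2 * ?t = of_int (int m - n) * pi"
    using ev n by (simp add: is_eigenfreq_def algebra_simps)
  have "0 < \<omega> + 2 * ?t" "\<omega> + 2 * ?t < 2 * pi" using \<omega> t by linarith+
  then have "int m - n = 1"
    using int_multiple_pi_between[of 0 "int m - n" 2] eq by simp
  \<comment> \<open>The angles \<omega> + t and t are supplementary, so their sines agree.\<close>
  then have pi: "\<omega> + ?t = pi - ?t" using eq by simp
  have "sin ?t = \<rho> * sin ?t" using sin_ar1_phase[OF \<rho>, of \<omega>] unfolding pi sin_pi_minus .
  moreover have "0 < sin ?t" using t by (intro sin_gt_zero) auto
  ultimately show False using \<rho> by simp
qed

theorem mainTheorem6:
  fixes N :: nat and \<rho> :: real
  assumes "2 \<le> N" and "even N" and "0 < \<rho>" and "\<rho> < 1"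
  shows "(\<forall>m\<in>{1..N}. eigenfreq N \<rho> m \<notin> dst1_grid N) \<and>
         (\<forall>m\<in>{1..N}. eigenfreq N \<rho> m \<notin> dct2_grid N)"
proof -
  have "is_eigenfreq N \<rho> m (eigenfreq N \<rho> m)" if "m \<in> {1..N}" for m
    using eigenfreq[OF assms(3,4)] that by simp
  moreover have "0 < N" using assms(1) by simp
  ultimately show ?thesis
    using eigenfreq_notin_dst1_grid[OF assms(3,4)] eigenfreq_notin_dct2_grid[OF _ assms(3,4)]
    by blast
qed

end
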